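(* Let $X$ be a topological space. The function sending a kernel of hyperbolic type $K\in\mathcal K(X)$ to its critical exponent $t_K\in\mathbb R_{\ge1}\sqcup\{\infty\}$ is upper semi-continuous. Moreover, if $t_K<\infty$ then $K^{t_K}\in\mathcal K(X)$.
   Context: A kernel on $X$ is a continuous symmetric function $K\colon X\times X\to\mathbb R$; it is of hyperbolic type when it is nonnegative, $K(x,x)=1$ for all $x$, and $\sum_{i,j=1}^n\lambda_i\lambda_jK(x_i,x_j)\le\big(\sum_{k=1}^n\lambda_kK(x_0,x_k)\big)^2$ for all $n$, $x_0,\dots,x_n\in X$, $\lambda\in\mathbb R^n$. $\mathcal K(X)$ is the set of kernels of hyperbolic type on $X$ with the topology of pointwise convergence. The critical exponent $t_K\in[1,\infty]$ is the supremum of $t\in[1,\infty)$ such that $K^t$ is a kernel of hyperbolic type. *)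

theory Defs
  imports "HOL-Analysis.Analysis"
begin

text \<open>
  A function on the product of the space with itself is represented by a function on pairs that is
  \<^const>\<open>extensional\<close> (has the value \<^const>\<open>undefined\<close> outside the carrier), so that equality of
  kernels is equality of functions on the carrier, as in the carrier of \<^const>\<open>product_topology\<close>.
\<close>

definition kernel_on :: "'a topology \<Rightarrow> ('a \<times> 'a \<Rightarrow> real) \<Rightarrow> bool" where
  "kernel_on X K \<longleftrightarrow>
     K \<in> extensional (topspace X \<times> topspace X) \<and>
     continuous_map (prod_topology X X) euclideanreal K \<and>
     (\<forall>x\<in>topspace X. \<forall>y\<in>topspace X. K (x, y) = K (y, x))"

definition hyperbolic_kernel_on :: "'a topology \<Rightarrow> ('a \<times> 'a \<Rightarrow> real) \<Rightarrow> bool" where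
  "hyperbolic_kernel_on X K \<longleftrightarrow>
     kernel_on X K \<and>
     (\<forall>x\<in>topspace X. \<forall>y\<in>topspace X. 0 \<le> K (x, y)) \<and>
     (\<forall>x\<in>topspace X. K (x, x) = 1) \<and>
     (\<forall>(n::nat) (x::nat \<Rightarrow> 'a) (l::nat \<Rightarrow> real).
        (\<forall>i\<le>n. x i \<in> topspace X) \<longrightarrow>
        (\<Sum>i=1..n. \<Sum>j=1..n. l i * l j * K (x i, x j)) \<le> (\<Sum>k=1..n. l k * K (x 0, x k))\<^sup>2)"

definition hyperbolic_kernels :: "'a topology \<Rightarrow> ('a \<times> 'a \<Rightarrow> real) set" where
  "hyperbolic_kernels X = {K. hyperbolic_kernel_on X K}"

text \<open>The topology of pointwise convergence.\<close>

definition hyperbolic_kernel_topology :: "'a topology \<Rightarrow> ('a \<times> 'a \<Rightarrow> real) topology" where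
  "hyperbolic_kernel_topology X =
     subtopology (product_topology (\<lambda>_. euclideanreal) (topspace X \<times> topspace X))
       (hyperbolic_kernels X)"

definition kernel_powr :: "'a topology \<Rightarrow> ('a \<times> 'a \<Rightarrow> real) \<Rightarrow> real \<Rightarrow> ('a \<times> 'a \<Rightarrow> real)" where
  "kernel_powr X K t = (\<lambda>p \<in> topspace X \<times> topspace X. K p powr t)"

definition critical_exponent :: "'a topology \<Rightarrow> ('a \<times> 'a \<Rightarrow> real) \<Rightarrow> ereal" where
  "critical_exponent X K = Sup {ereal t | t. 1 \<le> t \<and> hyperbolic_kernel_on X (kernel_powr X K t)}"

definition upper_semicontinuous_map :: "'a topology \<Rightarrow> ('a \<Rightarrow> 'b::linorder) \<Rightarrow> bool" where
  "upper_semicontinuous_map T f \<longleftrightarrow> (\<forall>a. openin T {x \<in> topspace T. f x < a})"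

lemma topspace_hyperbolic_kernel_topology [simp]:
  "topspace (hyperbolic_kernel_topology X) = hyperbolic_kernels X"
  by (auto simp: hyperbolic_kernel_topology_def hyperbolic_kernels_def hyperbolic_kernel_on_def
      kernel_on_def PiE_def)

lemma kernel_powr_one:
  assumes "hyperbolic_kernel_on X K"
  shows "kernel_powr X K 1 = K"
proof
  fix p show "kernel_powr X K 1 p = K p"
    using assms
    by (cases p) (auto simp: kernel_powr_def hyperbolic_kernel_on_def kernel_on_def
        extensional_def restrict_def)
qed

text \<open>On kernels of hyperbolic type the critical exponent takes its values in \<open>[1, \<infinity>]\<close>.\<close>

lemma one_le_critical_exponent:
  assumes "K \<in> hyperbolic_kernels X"
  shows "1 \<le> critical_exponent X K"
  unfolding critical_exponent_def
proof (rule Sup_upper)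
  have "hyperbolic_kernel_on X (kernel_powr X K 1)"
    using assms by (simp add: hyperbolic_kernels_def kernel_powr_one)
  then show "(1::ereal) \<in> {ereal t | t. 1 \<le> t \<and> hyperbolic_kernel_on X (kernel_powr X K t)}"
    by (auto simp: one_ereal_def)
qed

end

theory Submission
  imports Defs
begin

text \<open>
  A positive kernel \<open>K\<close> with \<open>K(x, x) = 1\<close> is of hyperbolic type iff each matrix
  \<open>P = 1 - K(x\<^sub>i, x\<^sub>j) / (K(x\<^sub>0, x\<^sub>i) K(x\<^sub>0, x\<^sub>j))\<close> is positive semidefinite. For \<open>0 \<le> s \<le> 1\<close> the binomial
  series of \<open>1 - (1 - P)\<^sup>s\<close> in \<open>P\<close> has no constant term and nonnegative coefficients, so by the
  Schur product theorem \<open>K\<^sup>s\<close> is of hyperbolic type whenever \<open>K\<close> is. Hence the exponents \<open>t \<ge> 1\<close> for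
  which \<open>K\<^sup>t\<close> is of hyperbolic type form an interval starting at \<open>1\<close>. Since the defining
  inequalities are closed conditions both in \<open>K\<close> and in \<open>t\<close>, the set of \<open>K\<close> whose interval misses \<open>t\<close> is
  open, which gives semicontinuity, and a finite supremum is attained.
\<close>

section \<open>Positive semidefinite matrices\<close>

text \<open>Only the quadratic form is recorded; symmetry is assumed separately where it is used.
  The explicit index set lets the form be restricted to pairs of indices and shrunk in
  inductions.\<close>

definition psd_on :: "'i set \<Rightarrow> ('i \<Rightarrow> 'i \<Rightarrow> real) \<Rightarrow> bool" where
  "psd_on S A \<longleftrightarrow> (\<forall>c. 0 \<le> (\<Sum>i\<in>S. \<Sum>j\<in>S. c i * c j * A i j))"

lemma psd_onD: "psd_on S A \<Longrightarrow> 0 \<le> (\<Sum>i\<in>S. \<Sum>j\<in>S. c i * c j * A i j)"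
  by (simp add: psd_on_def)

lemma quadratic_form_mono_neutral:
  fixes A :: "'i \<Rightarrow> 'i \<Rightarrow> real"
  assumes "finite S" "T \<subseteq> S" and "\<And>i j. i \<in> S \<Longrightarrow> j \<in> S \<Longrightarrow> i \<notin> T \<or> j \<notin> T \<Longrightarrow> c i * c j * A i j = 0"
  shows "(\<Sum>i\<in>S. \<Sum>j\<in>S. c i * c j * A i j) = (\<Sum>i\<in>T. \<Sum>j\<in>T. c i * c j * A i j)"
proof -
  have "(\<Sum>i\<in>S. \<Sum>j\<in>S. c i * c j * A i j) = (\<Sum>i\<in>T. \<Sum>j\<in>S. c i * c j * A i j)"
    using assms by (intro sum.mono_neutral_right ballI sum.neutral) auto
  also have "\<dots> = (\<Sum>i\<in>T. \<Sum>j\<in>T. c i * c j * A i j)"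
    using assms by (intro sum.cong refl sum.mono_neutral_right ballI) auto
  finally show ?thesis .
qed

lemma psd_on_subset:
  assumes "finite S" "T \<subseteq> S" "psd_on S A"
  shows "psd_on T A"
  unfolding psd_on_def
proof
  fix c :: "'a \<Rightarrow> real"
  let ?d = "\<lambda>i. if i \<in> T then c i else 0"
  have "0 \<le> (\<Sum>i\<in>S. \<Sum>j\<in>S. ?d i * ?d j * A i j)"
    by (rule psd_onD[OF assms(3)])
  also have "\<dots> = (\<Sum>i\<in>T. \<Sum>j\<in>T. ?d i * ?d j * A i j)"
    by (rule quadratic_form_mono_neutral) (use assms in auto)
  also have "\<dots> = (\<Sum>i\<in>T. \<Sum>j\<in>T. c i * c j * A i j)"
    by (intro sum.cong) auto
  finally show "0 \<le> (\<Sum>i\<in>T. \<Sum>j\<in>T. c i * c j * A i j)" .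
qed

lemma psd_on_diag:
  assumes "finite S" "psd_on S A" "i \<in> S"
  shows "0 \<le> A i i"
proof -
  have "psd_on {i} A"
    using assms by (auto intro: psd_on_subset)
  from psd_onD[OF this, of "\<lambda>_. 1"] show ?thesis by simp
qed

text \<open>Restricted to \<open>{i, j}\<close>, the form is a nonnegative binary quadratic form, so
  its discriminant is not positive.\<close>

lemma psd_on_square_le:
  assumes "finite S" "psd_on S A" and sym: "\<And>i j. i \<in> S \<Longrightarrow> j \<in> S \<Longrightarrow> A i j = A j i"
    and ij: "i \<in> S" "j \<in> S"
  shows "(A i j)\<^sup>2 \<le> A i i * A j j"
proof (cases "i = j")
  case True
  then show ?thesis by (simp add: power2_eq_square)
next
  case False
  have psd: "psd_on {i, j} A"
    using assms by (auto intro: psd_on_subset)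
  have form: "0 \<le> s * s * A i i + 2 * s * t * A i j + t * t * A j j" for s t
    using psd_onD[OF psd, of "\<lambda>k. if k = i then s else t"] False sym[OF ij]
    by (simp add: algebra_simps)
  have nonneg: "0 \<le> A i i"
    using form[of 1 0] by simp
  show ?thesis
  proof (cases "A i i = 0")
    case True
    \<comment> \<open>With \<open>A i i = 0\<close> the form is affine in \<open>s\<close>; if
      \<open>A i j\<close> were nonzero, this choice of \<open>s\<close> would give it the value
      -1.\<close>
    have "A i j = 0"
      using form[of "- (A j j + 1) / (2 * A i j)" 1] True
      by (cases "A i j = 0") (auto simp: field_simps)
    then show ?thesis using True by simp
  next
    case False
    \<comment> \<open>For \<open>t = A i i\<close> the form is minimal in \<open>s\<close> at
      \<open>- A i j\<close>.\<close>
    have "0 \<le> A i i * (A i i * A j j - (A i j)\<^sup>2)"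
      using form[of "- A i j" "A i i"] by (simp add: algebra_simps power2_eq_square)
    then show ?thesis
      using False nonneg by (simp add: zero_le_mult_iff)
  qed
qed

text \<open>Evaluating the form of \<open>A\<close> at \<open>c\<close> minus its
  \<open>A\<close>-orthogonal projection onto the basis vector of \<open>a\<close> gives the form of
  the new matrix at \<open>c\<close>. If \<open>A a a = 0\<close>, the quotient is 0 by convention
  and the matrix is \<open>A\<close> itself.\<close>

lemma psd_on_schur_complement:
  assumes "finite S" "psd_on S A" and sym: "\<And>i j. i \<in> S \<Longrightarrow> j \<in> S \<Longrightarrow> A i j = A j i"
    and a: "a \<in> S"
  shows "psd_on S (\<lambda>i j. A i j - A a i * A a j / A a a)"
proof (cases "A a a = 0")
  case True
  then show ?thesis using assms(2) by simp
next
  case False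
  show ?thesis
    unfolding psd_on_def
  proof
    fix c :: "'a \<Rightarrow> real"
    define r where "r = (\<Sum>i\<in>S. c i * A a i)"
    \<comment> \<open>This is the projection of \<open>c\<close>: pairing it through
      \<open>A\<close> with \<open>c\<close>, on either side, or with itself gives
      \<open>r * r / A a a\<close>.\<close>
    define e where "e = (\<lambda>i. if i = a then r / A a a else 0)"
    have e_sum: "(\<Sum>i\<in>S. e i * f i) = r / A a a * f a" for f
    proof -
      have "(\<Sum>i\<in>S. e i * f i) = (\<Sum>i\<in>S. if i = a then r / A a a * f i else 0)"
        by (intro sum.cong) (auto simp: e_def)
      then show ?thesis using assms(1) a by simp
    qed
    have ce: "(\<Sum>i\<in>S. \<Sum>j\<in>S. c i * e j * A i j) = r * r / A a a"
    proof -
      have "(\<Sum>i\<in>S. \<Sum>j\<in>S. c i * e j * A i j) = (\<Sum>i\<in>S. c i * (\<Sum>j\<in>S. e j * A i j))"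
        by (simp add: sum_distrib_left mult_ac)
      also have "\<dots> = (\<Sum>i\<in>S. c i * A a i) * (r / A a a)"
        unfolding e_sum sum_distrib_right using sym a by (intro sum.cong) auto
      finally show ?thesis by (simp add: r_def)
    qed
    have ec: "(\<Sum>i\<in>S. \<Sum>j\<in>S. e i * c j * A i j) = r * r / A a a"
    proof -
      have "(\<Sum>i\<in>S. \<Sum>j\<in>S. e i * c j * A i j) = (\<Sum>i\<in>S. e i * (\<Sum>j\<in>S. c j * A i j))"
        by (simp add: sum_distrib_left mult_ac)
      then show ?thesis unfolding e_sum by (simp add: r_def)
    qed
    have ee: "(\<Sum>i\<in>S. \<Sum>j\<in>S. e i * e j * A i j) = r * r / A a a"
    proof -
      have "(\<Sum>i\<in>S. \<Sum>j\<in>S. e i * e j * A i j) = (\<Sum>i\<in>S. e i * (\<Sum>j\<in>S. e j * A i j))"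
        by (simp add: sum_distrib_left mult_ac)
      then show ?thesis unfolding e_sum using False by simp
    qed
    have "(\<Sum>i\<in>S. \<Sum>j\<in>S. c i * c j * (A a i * A a j / A a a)) = r * r / A a a"
      by (simp add: r_def sum_product sum_divide_distrib mult_ac)
    then have "(\<Sum>i\<in>S. \<Sum>j\<in>S. c i * c j * (A i j - A a i * A a j / A a a))
        = (\<Sum>i\<in>S. \<Sum>j\<in>S. c i * c j * A i j) - r * r / A a a"
      by (simp add: right_diff_distrib sum_subtractf)
    also have "\<dots> = (\<Sum>i\<in>S. \<Sum>j\<in>S. (c i - e i) * (c j - e j) * A i j)"
      using ce ec ee by (simp add: algebra_simps sum_subtractf sum.distrib)
    finally show "0 \<le> (\<Sum>i\<in>S. \<Sum>j\<in>S. c i * c j * (A i j - A a i * A a j / A a a))"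
      using psd_onD[OF assms(2)] by simp
  qed
qed

text \<open>Split \<open>A\<close> into its Schur complement \<open>A'\<close> at the new index
  \<open>a\<close> and a rank-one part. \<open>A'\<close> vanishes in row and column
  \<open>a\<close>, so its product with \<open>B\<close> is handled by induction; the rank-one part
  contributes the form of \<open>B\<close> at a rescaled vector.\<close>

lemma psd_on_schur_product:
  assumes "finite S" "psd_on S A" "\<And>i j. i \<in> S \<Longrightarrow> j \<in> S \<Longrightarrow> A i j = A j i" "psd_on S B"
  shows "psd_on S (\<lambda>i j. A i j * B i j)"
  using assms
proof (induction S arbitrary: A rule: finite_induct)
  case empty
  then show ?case by (simp add: psd_on_def)
next
  case (insert a F)
  let ?S = "insert a F"
  define A' where "A' = (\<lambda>i j. A i j - A a i * A a j / A a a)"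
  have fin: "finite ?S" using insert.hyps by simp
  \<comment> \<open>In the degenerate case \<open>A'\<close> equals \<open>A\<close>, whose row at
    \<open>a\<close> must then vanish by the bound on squared entries.\<close>
  have row: "A a j = 0" if "j \<in> ?S" "A a a = 0" for j
    using psd_on_square_le[OF fin insert.prems(1,2), of a j] that by simp
  have zero: "A' a j = 0" "A' j a = 0" if "j \<in> ?S" for j
    using row[OF that] insert.prems(2)[of j a] that by (auto simp: A'_def)
  have "psd_on ?S A'"
    unfolding A'_def by (rule psd_on_schur_complement[OF fin insert.prems(1,2)]) auto
  then have psd: "psd_on F (\<lambda>i j. A' i j * B i j)"
    using insert.prems fin
    by (intro insert.IH) (auto simp: A'_def mult.commute intro: psd_on_subset[OF fin])
  have diag: "0 \<le> A a a"
    using psd_on_diag[OF fin insert.prems(1)] by simp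
  show ?case
    unfolding psd_on_def
  proof
    fix c :: "'a \<Rightarrow> real"
    have "c i * c j * (A i j * B i j) = c i * c j * (A' i j * B i j)
        + (c i * A a i) * (c j * A a j) * B i j / A a a" for i j
      by (simp add: A'_def algebra_simps)
    then have "(\<Sum>i\<in>?S. \<Sum>j\<in>?S. c i * c j * (A i j * B i j))
        = (\<Sum>i\<in>?S. \<Sum>j\<in>?S. c i * c j * (A' i j * B i j))
          + (\<Sum>i\<in>?S. \<Sum>j\<in>?S. (c i * A a i) * (c j * A a j) * B i j) / A a a"
      by (simp only: sum.distrib sum_divide_distrib)
    also have "(\<Sum>i\<in>?S. \<Sum>j\<in>?S. c i * c j * (A' i j * B i j))
        = (\<Sum>i\<in>F. \<Sum>j\<in>F. c i * c j * (A' i j * B i j))"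
      by (rule quadratic_form_mono_neutral) (use fin zero in auto)
    finally show "0 \<le> (\<Sum>i\<in>?S. \<Sum>j\<in>?S. c i * c j * (A i j * B i j))"
      using psd_onD[OF psd, of c] psd_onD[OF insert.prems(3), of "\<lambda>i. c i * A a i"] diag
      by simp
  qed
qed

lemma psd_on_power:
  assumes "finite S" "psd_on S A" "\<And>i j. i \<in> S \<Longrightarrow> j \<in> S \<Longrightarrow> A i j = A j i"
  shows "psd_on S (\<lambda>i j. A i j ^ k)"
proof (induction k)
  case 0
  have "(\<Sum>i\<in>S. \<Sum>j\<in>S. c i * c j) = (\<Sum>i\<in>S. c i)\<^sup>2" for c :: "'a \<Rightarrow> real"
    by (simp add: power2_eq_square sum_product)
  then show ?case by (simp add: psd_on_def)
next
  case (Suc k)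
  then show ?case using psd_on_schur_product[OF assms Suc] by simp
qed

section \<open>The binomial series for exponents in the unit interval\<close>

text \<open>Up to the positive factor \<open>1 / fact k\<close>, the left side is
  -s(1-s)(2-s)...(k-1-s), in which only the first factor can be negative.\<close>

lemma gbinomial_sign:
  fixes s :: real
  assumes "0 \<le> s" "s \<le> 1" "0 < k"
  shows "(s gchoose k) * (-1) ^ k \<le> 0"
proof -
  obtain m where k: "k = Suc m" using assms(3) gr0_implies_Suc by blast
  have "(s gchoose k) * (-1) ^ k = pochhammer (- s) k / fact k"
    by (simp add: gbinomial_pochhammer flip: power_add mult_2)
  also have "\<dots> = - s * pochhammer (1 - s) m / fact k"
    by (simp add: k pochhammer_rec add.commute)
  also have "\<dots> \<le> 0"
    using assms by (auto intro!: divide_nonpos_pos mult_nonneg_nonneg pochhammer_nonneg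
        simp: pochhammer_prod prod_nonneg)
  finally show ?thesis .
qed

lemma psd_on_one_minus_powr:
  assumes "finite S" "psd_on S P" and sym: "\<And>i j. i \<in> S \<Longrightarrow> j \<in> S \<Longrightarrow> P i j = P j i"
    and diag: "\<And>i. i \<in> S \<Longrightarrow> P i i < 1" and s: "0 \<le> s" "s \<le> 1"
  shows "psd_on S (\<lambda>i j. 1 - (1 - P i j) powr s)"
  unfolding psd_on_def
proof
  fix c :: "'a \<Rightarrow> real"
  \<comment> \<open>Together with positive semidefiniteness, the bound on the diagonal controls
    every entry, so the binomial series converges at each of them.\<close>
  have small: "\<bar>P i j\<bar> < 1" if "i \<in> S" "j \<in> S" for i j
  proof -
    have "(P i j)\<^sup>2 \<le> P i i * P j j"
      by (rule psd_on_square_le[OF assms(1,2) sym that])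
    also have "\<dots> \<le> P i i * 1"
      using that diag[of j] psd_on_diag[OF assms(1,2)] by (intro mult_left_mono) auto
    also have "\<dots> < 1" using diag that by simp
    finally show ?thesis by (simp add: abs_square_less_1)
  qed
  \<comment> \<open>These are the coefficients of 1 - (1-u)^s in powers of u; the leading 1 cancels
    the constant term.\<close>
  define b where "b = (\<lambda>k. if k = 0 then 0 else - ((s gchoose k) * (-1) ^ k))"
  have b: "0 \<le> b k" for k
    using gbinomial_sign[OF s, of k] by (simp add: b_def)
  have series: "(\<lambda>k. b k * P i j ^ k) sums (1 - (1 - P i j) powr s)" if "i \<in> S" "j \<in> S" for i j
  proof -
    have "(\<lambda>k. (s gchoose k) * (- P i j) ^ k) sums (1 + - P i j) powr s"
      using small[OF that] by (intro gen_binomial_real) simp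
    from sums_diff[OF sums_single[of 0 "\<lambda>_. 1"] this]
    have "(\<lambda>k. (if k = 0 then 1 else 0) - (s gchoose k) * (- P i j) ^ k)
        sums (1 - (1 - P i j) powr s)"
      by simp
    moreover have "(if k = 0 then 1 else 0) - (s gchoose k) * (- P i j) ^ k = b k * P i j ^ k" for k
      using power_minus[of "P i j" k] by (simp add: b_def mult_ac)
    ultimately show ?thesis by simp
  qed
  \<comment> \<open>\<open>S\<close> is finite, so the entrywise series add up to a series for the
    form, whose terms are nonnegative by \<open>psd_on_power\<close>.\<close>
  have total: "(\<lambda>k. \<Sum>i\<in>S. \<Sum>j\<in>S. c i * c j * (b k * P i j ^ k))
      sums (\<Sum>i\<in>S. \<Sum>j\<in>S. c i * c j * (1 - (1 - P i j) powr s))"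
    by (intro sums_sum sums_mult series)
  have nonneg: "0 \<le> (\<Sum>i\<in>S. \<Sum>j\<in>S. c i * c j * (b k * P i j ^ k))" for k
  proof -
    have "(\<Sum>i\<in>S. \<Sum>j\<in>S. c i * c j * (b k * P i j ^ k))
        = b k * (\<Sum>i\<in>S. \<Sum>j\<in>S. c i * c j * P i j ^ k)"
      by (simp add: sum_distrib_left mult_ac)
    then show ?thesis
      using b psd_onD[OF psd_on_power[OF assms(1,2) sym]] by simp
  qed
  show "0 \<le> (\<Sum>i\<in>S. \<Sum>j\<in>S. c i * c j * (1 - (1 - P i j) powr s))"
    by (rule sums_le[OF nonneg sums_zero total])
qed

section \<open>Powers of kernels of hyperbolic type\<close>

lemma hyperbolic_kernel_on_ineq:
  fixes n :: nat
  assumes "hyperbolic_kernel_on X K" "\<And>i. i \<le> n \<Longrightarrow> x i \<in> topspace X"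
  shows "(\<Sum>i=1..n. \<Sum>j=1..n. l i * l j * K (x i, x j)) \<le> (\<Sum>k=1..n. l k * K (x 0, x k))\<^sup>2"
  using assms by (simp add: hyperbolic_kernel_on_def)

text \<open>The case \<open>n = 1\<close> of the inequality, with base point \<open>x\<close> and
  single point \<open>y\<close>, reads 1 \<le> K(x,y)^2. The resulting positivity permits division
  by values of \<open>K\<close> and makes their real powers continuous.\<close>

lemma hyperbolic_kernel_on_ge_1:
  assumes "hyperbolic_kernel_on X K" "x \<in> topspace X" "y \<in> topspace X"
  shows "1 \<le> K (x, y)"
proof -
  let ?x = "\<lambda>i::nat. if i = 0 then x else y"
  have "1 \<le> (K (x, y))\<^sup>2"
    using hyperbolic_kernel_on_ineq[of X K 1 ?x "\<lambda>_. 1"] assms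
    by (simp add: hyperbolic_kernel_on_def)
  moreover have "0 \<le> K (x, y)"
    using assms by (simp add: hyperbolic_kernel_on_def)
  ultimately show ?thesis
    by (simp add: power2_ge_1_iff)
qed

lemma continuous_map_powr_const:
  fixes f :: "'a \<Rightarrow> real"
  assumes "continuous_map T euclideanreal f" and "\<And>x. x \<in> topspace T \<Longrightarrow> 0 < f x"
  shows "continuous_map T euclideanreal (\<lambda>x. f x powr t)"
proof -
  have "continuous_map T (top_of_set {0<..}) f"
    using assms by (auto simp: continuous_map_in_subtopology)
  moreover have "continuous_map (top_of_set {0<..}) euclideanreal (\<lambda>u::real. u powr t)"
    by (auto intro!: continuous_intros)
  ultimately show ?thesis
    using continuous_map_compose[of T _ f euclideanreal "\<lambda>u. u powr t"] by (simp add: o_def)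
qed

text \<open>Continuity, symmetry, nonnegativity and the unit diagonal pass from \<open>K\<close> to
  its powers, so only the inequality remains. It is stated with bare powers, which agree with
  \<open>kernel_powr\<close> on the carrier.\<close>

lemma hyperbolic_kernel_on_powr_iff:
  assumes "hyperbolic_kernel_on X K"
  shows "hyperbolic_kernel_on X (kernel_powr X K t) \<longleftrightarrow>
    (\<forall>(n::nat) (x::nat \<Rightarrow> 'a) (l::nat \<Rightarrow> real). (\<forall>i\<le>n. x i \<in> topspace X) \<longrightarrow>
      (\<Sum>i=1..n. \<Sum>j=1..n. l i * l j * K (x i, x j) powr t)
        \<le> (\<Sum>k=1..n. l k * K (x 0, x k) powr t)\<^sup>2)"
proof -
  have pos: "0 < K (x, y)" if "x \<in> topspace X" "y \<in> topspace X" for x y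
    using hyperbolic_kernel_on_ge_1[OF assms that] by simp
  have "continuous_map (prod_topology X X) euclideanreal (\<lambda>p. K p powr t)"
    using assms pos
    by (intro continuous_map_powr_const) (auto simp: hyperbolic_kernel_on_def kernel_on_def)
  then have "continuous_map (prod_topology X X) euclideanreal (kernel_powr X K t)"
    by (rule continuous_map_eq) (simp add: kernel_powr_def)
  then have "kernel_on X (kernel_powr X K t)"
    using assms by (auto simp: kernel_on_def hyperbolic_kernel_on_def kernel_powr_def)
  moreover have "(\<Sum>i=1..n. \<Sum>j=1..n. l i * l j * kernel_powr X K t (x i, x j))
        = (\<Sum>i=1..n. \<Sum>j=1..n. l i * l j * K (x i, x j) powr t)"
      "(\<Sum>k=1..n. l k * kernel_powr X K t (x 0, x k)) = (\<Sum>k=1..n. l k * K (x 0, x k) powr t)"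
    if "\<forall>i\<le>n. x i \<in> topspace X" for n l and x :: "nat \<Rightarrow> 'a"
    using that by (auto simp: kernel_powr_def intro!: sum.cong)
  moreover have "K (x, x) = 1" if "x \<in> topspace X" for x
    using that assms by (simp add: hyperbolic_kernel_on_def)
  ultimately show ?thesis
    unfolding hyperbolic_kernel_on_def by (auto simp: kernel_powr_def)
qed

lemma hyperbolic_kernel_on_powr:
  assumes K: "hyperbolic_kernel_on X K" and s: "0 \<le> s" "s \<le> 1"
  shows "hyperbolic_kernel_on X (kernel_powr X K s)"
  unfolding hyperbolic_kernel_on_powr_iff[OF K]
proof (intro allI impI)
  fix n :: nat and x :: "nat \<Rightarrow> 'a" and l :: "nat \<Rightarrow> real"
  assume x: "\<forall>i\<le>n. x i \<in> topspace X"
  define S where "S = {1..n}"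
  define f where "f = (\<lambda>i. K (x 0, x i))"
  \<comment> \<open>Normalising by the values \<open>f\<close> at the base point turns the right
    side of the inequality into the square of the plain sum of coefficients; the inequality then
    says that \<open>P\<close> is positive semidefinite.\<close>
  define P where "P = (\<lambda>i j. 1 - K (x i, x j) / (f i * f j))"
  have f: "1 \<le> f i" if "i \<in> S" for i
    using that x hyperbolic_kernel_on_ge_1[OF K] by (simp add: f_def S_def)
  have f0: "f i \<noteq> 0" "0 < f i" if "i \<in> S" for i
    using f[OF that] by auto
  have K1: "1 \<le> K (x i, x j)" if "i \<in> S" "j \<in> S" for i j
    using that x hyperbolic_kernel_on_ge_1[OF K] by (simp add: S_def)
  have sym: "P i j = P j i" if "i \<in> S" "j \<in> S" for i j
    using K x that
    by (simp add: P_def hyperbolic_kernel_on_def kernel_on_def S_def mult.commute)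
  have diag: "P i i < 1" if "i \<in> S" for i
    using K1[OF that that] f[OF that] by (simp add: P_def)
  have "psd_on S P"
    unfolding psd_on_def
  proof
    fix c :: "nat \<Rightarrow> real"
    have "(\<Sum>i\<in>S. \<Sum>j\<in>S. (c i / f i) * (c j / f j) * K (x i, x j)) \<le> (\<Sum>k\<in>S. c k / f k * f k)\<^sup>2"
      unfolding S_def f_def by (rule hyperbolic_kernel_on_ineq[OF K]) (use x in simp)
    also have "(\<Sum>k\<in>S. c k / f k * f k) = (\<Sum>k\<in>S. c k)"
      using f0 by (intro sum.cong) auto
    also have "(\<Sum>k\<in>S. c k)\<^sup>2 = (\<Sum>i\<in>S. \<Sum>j\<in>S. c i * c j)"
      by (simp add: power2_eq_square sum_product)
    finally show "0 \<le> (\<Sum>i\<in>S. \<Sum>j\<in>S. c i * c j * P i j)"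
      by (simp add: P_def right_diff_distrib sum_subtractf)
  qed
  \<comment> \<open>The weights \<open>f i powr s\<close> undo the normalisation, since f_i^s f_j^s
    (1 - P_ij)^s = K(x_i,x_j)^s.\<close>
  from psd_onD[OF psd_on_one_minus_powr[OF _ this sym diag s], of "\<lambda>i. l i * f i powr s"]
  have "0 \<le> (\<Sum>i\<in>S. \<Sum>j\<in>S. l i * f i powr s * (l j * f j powr s) * (1 - (1 - P i j) powr s))"
    by (simp add: S_def)
  also have "\<dots> = (\<Sum>i\<in>S. \<Sum>j\<in>S. l i * f i powr s * (l j * f j powr s)
      - l i * l j * K (x i, x j) powr s)"
  proof (intro sum.cong refl)
    fix i j assume ij: "i \<in> S" "j \<in> S"
    have eq: "f i powr s * f j powr s * (1 - P i j) powr s = K (x i, x j) powr s"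
      using f0[OF ij(1)] f0[OF ij(2)] K1[OF ij] by (simp add: P_def flip: powr_mult)
    show "l i * f i powr s * (l j * f j powr s) * (1 - (1 - P i j) powr s)
        = l i * f i powr s * (l j * f j powr s) - l i * l j * K (x i, x j) powr s"
      by (simp add: right_diff_distrib mult_ac flip: eq)
  qed
  also have "\<dots> = (\<Sum>k\<in>S. l k * f k powr s)\<^sup>2
      - (\<Sum>i\<in>S. \<Sum>j\<in>S. l i * l j * K (x i, x j) powr s)"
    by (simp add: sum_subtractf power2_eq_square sum_product)
  finally show "(\<Sum>i=1..n. \<Sum>j=1..n. l i * l j * K (x i, x j) powr s)
      \<le> (\<Sum>k=1..n. l k * K (x 0, x k) powr s)\<^sup>2"
    by (simp add: S_def f_def)
qed

text \<open>For \<open>t\<close> nonzero, K^s is the power of K^t with exponent s/t, which lies in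
  [0,1]; for \<open>t = 0\<close> also \<open>s = 0\<close>.\<close>

lemma hyperbolic_kernel_on_powr_downward:
  assumes K: "hyperbolic_kernel_on X (kernel_powr X K t)" and s: "0 \<le> s" "s \<le> t"
  shows "hyperbolic_kernel_on X (kernel_powr X K s)"
proof (cases "t = 0")
  case True
  then show ?thesis using assms by simp
next
  case False
  have "kernel_powr X (kernel_powr X K t) (s / t) = kernel_powr X K s"
    using False by (auto simp: kernel_powr_def fun_eq_iff powr_powr)
  then show ?thesis
    using hyperbolic_kernel_on_powr[OF K, of "s / t"] s False by simp
qed

section \<open>The critical exponent\<close>

text \<open>Failure is witnessed by one finite configuration violating the inequality strictly. The
  violation involves finitely many values of \<open>K\<close>, so it persists on a neighbourhood for
  pointwise convergence.\<close>

lemma openin_Collect_not_hyperbolic_powr: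
  "openin (hyperbolic_kernel_topology X)
     {K \<in> hyperbolic_kernels X. \<not> hyperbolic_kernel_on X (kernel_powr X K t)}"
proof -
  let ?T = "hyperbolic_kernel_topology X"
  have cont: "continuous_map ?T euclideanreal (\<lambda>K. K (x, y) powr t)"
    if "x \<in> topspace X" "y \<in> topspace X" for x y
  proof -
    have "continuous_map ?T euclideanreal (\<lambda>K. K (x, y))"
      unfolding hyperbolic_kernel_topology_def using that
      by (intro continuous_map_from_subtopology continuous_map_product_projection) auto
    moreover have "0 < K (x, y)" if "K \<in> hyperbolic_kernels X" for K
      using hyperbolic_kernel_on_ge_1[of X K x y] that \<open>x \<in> topspace X\<close> \<open>y \<in> topspace X\<close>
      by (simp add: hyperbolic_kernels_def)
    ultimately show ?thesis
      by (intro continuous_map_powr_const) auto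
  qed
  define gap where "gap = (\<lambda>(n::nat, x::nat \<Rightarrow> 'a, l::nat \<Rightarrow> real) K.
      (\<Sum>k=1..n. l k * K (x 0, x k) powr t)\<^sup>2
        - (\<Sum>i=1..n. \<Sum>j=1..n. l i * l j * K (x i, x j) powr t))"
  define V where "V = (\<lambda>p. {K \<in> topspace ?T. gap p K \<in> {..<0}})"
  define I where "I = {(n::nat, x, l :: nat \<Rightarrow> real). \<forall>i\<le>n. x i \<in> topspace X}"
  have "openin ?T (V (n, x, l))" if "\<forall>i\<le>n. x i \<in> topspace X" for n x l
    unfolding V_def gap_def prod.case using that
    by (intro openin_continuous_map_preimage[where Y=euclideanreal] continuous_map_diff
        continuous_map_real_pow continuous_map_sum continuous_map_real_mult_left cont) auto
  then have "openin ?T (\<Union>(V ` I))"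
    by (intro openin_Union) (auto simp: I_def)
  moreover have "hyperbolic_kernel_on X (kernel_powr X K t) \<longleftrightarrow> (\<forall>p\<in>I. 0 \<le> gap p K)"
    if "K \<in> hyperbolic_kernels X" for K
    using that by (simp add: hyperbolic_kernels_def hyperbolic_kernel_on_powr_iff gap_def I_def)
  then have "{K \<in> hyperbolic_kernels X. \<not> hyperbolic_kernel_on X (kernel_powr X K t)} = \<Union>(V ` I)"
    by (fastforce simp: V_def not_le)
  ultimately show ?thesis by simp
qed

text \<open>The admissible exponents are downward closed in [1,\<infinity>), so an exponent that
  fails bounds their supremum. Conversely, any real strictly between the supremum and
  \<open>a\<close> fails.\<close>

lemma critical_exponent_less_iff:
  assumes "K \<in> hyperbolic_kernels X"
  shows "critical_exponent X K < a \<longleftrightarrow>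
    (\<exists>t\<ge>1. ereal t < a \<and> \<not> hyperbolic_kernel_on X (kernel_powr X K t))"
proof
  assume "critical_exponent X K < a"
  then obtain t where t: "critical_exponent X K < ereal t" "ereal t < a"
    using ereal_dense2 by blast
  have "1 \<le> t"
    using order_le_less_trans[OF one_le_critical_exponent[OF assms] t(1)] by simp
  moreover have "\<not> hyperbolic_kernel_on X (kernel_powr X K t)"
    using t(1) \<open>1 \<le> t\<close> Sup_upper unfolding critical_exponent_def
    by (metis (mono_tags, lifting) mem_Collect_eq not_less)
  ultimately show "\<exists>t\<ge>1. ereal t < a \<and> \<not> hyperbolic_kernel_on X (kernel_powr X K t)"
    using t(2) by blast
next
  assume "\<exists>t\<ge>1. ereal t < a \<and> \<not> hyperbolic_kernel_on X (kernel_powr X K t)"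
  then obtain t where t: "1 \<le> t" "ereal t < a" "\<not> hyperbolic_kernel_on X (kernel_powr X K t)"
    by blast
  have "critical_exponent X K \<le> ereal t"
    unfolding critical_exponent_def
  proof (rule Sup_least)
    fix u assume "u \<in> {ereal t |t. 1 \<le> t \<and> hyperbolic_kernel_on X (kernel_powr X K t)}"
    then show "u \<le> ereal t"
      using hyperbolic_kernel_on_powr_downward[of X K _ t] t by clarsimp (meson linear)
  qed
  then show "critical_exponent X K < a" using t(2) by simp
qed

text \<open>For fixed points and coefficients both sides are continuous in \<open>t\<close>, because
  the values of \<open>K\<close> are nonzero; the set is an intersection of closed
  conditions.\<close>

lemma closed_hyperbolic_powers:
  assumes K: "hyperbolic_kernel_on X K"
  shows "closed {t. hyperbolic_kernel_on X (kernel_powr X K t)}"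
  unfolding hyperbolic_kernel_on_powr_iff[OF K]
proof (intro closed_Collect_all)
  fix n :: nat and x :: "nat \<Rightarrow> 'a" and l :: "nat \<Rightarrow> real"
  show "closed {t. (\<forall>i\<le>n. x i \<in> topspace X) \<longrightarrow>
      (\<Sum>i=1..n. \<Sum>j=1..n. l i * l j * K (x i, x j) powr t)
        \<le> (\<Sum>k=1..n. l k * K (x 0, x k) powr t)\<^sup>2}"
  proof (cases "\<forall>i\<le>n. x i \<in> topspace X")
    case True
    then have "K (x i, x j) \<noteq> 0" if "i \<le> n" "j \<le> n" for i j
      using hyperbolic_kernel_on_ge_1[OF K, of "x i" "x j"] that by force
    then show ?thesis
      using True by (auto intro!: closed_Collect_le continuous_intros)
  next
    case False
    then show ?thesis
      by (simp only: simp_thms closed_UNIV flip: UNIV_def)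
  qed
qed

lemma hyperbolic_kernel_on_critical_power:
  assumes K: "hyperbolic_kernel_on X K" and fin: "critical_exponent X K < \<infinity>"
  shows "hyperbolic_kernel_on X (kernel_powr X K (real_of_ereal (critical_exponent X K)))"
proof -
  define S where "S = {t. 1 \<le> t \<and> hyperbolic_kernel_on X (kernel_powr X K t)}"
  have crit: "critical_exponent X K = (SUP t\<in>S. ereal t)"
    unfolding critical_exponent_def S_def by (intro arg_cong[where f = Sup]) auto
  have "1 \<in> S"
    using K by (simp add: S_def kernel_powr_one)
  obtain r where r: "critical_exponent X K = ereal r"
    using fin one_le_critical_exponent[of K X] K
    by (cases "critical_exponent X K") (auto simp: hyperbolic_kernels_def)
  \<comment> \<open>Finiteness of the critical exponent makes the extended supremum a real one, to
    which closedness of \<open>S\<close> applies.\<close>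
  have "ereal (Sup S) = (SUP t\<in>S. ereal t)"
    using r crit by (intro ereal_Sup) simp
  have bdd: "bdd_above S"
    using r crit by (metis SUP_upper bdd_aboveI ereal_less_eq(3))
  have "closed S"
    using closed_Int[OF closed_atLeast[of 1] closed_hyperbolic_powers[OF K]]
    by (simp add: S_def Collect_conj_eq atLeast_def)
  then have "Sup S \<in> S"
    using \<open>1 \<in> S\<close> bdd by (intro closed_contains_Sup) auto
  moreover have "real_of_ereal (critical_exponent X K) = Sup S"
    unfolding crit \<open>ereal (Sup S) = _\<close>[symmetric] by simp
  ultimately show ?thesis by (simp add: S_def)
qed

theorem proposition5p5:
  fixes X :: "'a topology"
  shows "upper_semicontinuous_map (hyperbolic_kernel_topology X) (critical_exponent X) \<and>
         (\<forall>K \<in> hyperbolic_kernels X. critical_exponent X K < \<infinity> \<longrightarrow>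
            kernel_powr X K (real_of_ereal (critical_exponent X K)) \<in> hyperbolic_kernels X)"
proof
  show "upper_semicontinuous_map (hyperbolic_kernel_topology X) (critical_exponent X)"
    unfolding upper_semicontinuous_map_def
  proof
    fix a
    \<comment> \<open>Each sublevel set is a union of open failure sets. This covers
      \<open>a = \<infinity>\<close>, and for \<open>a \<le> 1\<close> both sides are empty.\<close>
    have "{K \<in> topspace (hyperbolic_kernel_topology X). critical_exponent X K < a}
        = (\<Union>t\<in>{t. 1 \<le> t \<and> ereal t < a}.
            {K \<in> hyperbolic_kernels X. \<not> hyperbolic_kernel_on X (kernel_powr X K t)})"
      by (auto simp: critical_exponent_less_iff)
    then show "openin (hyperbolic_kernel_topology X)
        {K \<in> topspace (hyperbolic_kernel_topology X). critical_exponent X K < a}"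
      by (auto intro!: openin_Union openin_Collect_not_hyperbolic_powr)
  qed
  show "\<forall>K \<in> hyperbolic_kernels X. critical_exponent X K < \<infinity> \<longrightarrow>
      kernel_powr X K (real_of_ereal (critical_exponent X K)) \<in> hyperbolic_kernels X"
    using hyperbolic_kernel_on_critical_power by (auto simp: hyperbolic_kernels_def)
qed

end
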